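(* Let $n,D\ge 1$ be integers and $p\in[0,1]$. Let $I\subseteq S=k[x_1,\dots,x_n]$ be a fixed monomial ideal generated by non-constant monomials of degree at most $D$ (the zero ideal is allowed). If $\mathfrak I\sim\mathcal I(n,D,p)$, then $$P(\mathfrak I=I)=p^{\beta_1(S/I)}\,(1-p)^{\sum_{d=1}^{D}h_I(d)}.$$
   Context: Let $k$ be a field and $S=k[x_1,\dots,x_n]$. $\mathcal B(n,D,p)$ is the distribution of the random set $\mathfrak B$ of monomials of $S$ obtained by including each non-constant monomial of total degree at most $D$ independently with probability $p$. $\mathcal I(n,D,p)$ is the distribution of the random monomial ideal $\mathfrak I=(\mathfrak B)$ generated by such a set, with the convention that $\mathfrak I=(0)$ if $\mathfrak B=\emptyset$. For a monomial ideal $I$: $\beta_1(S/I)$ is the number of minimal monomial generators of $I$, and $h_I(d)$ is the Hilbert function, i.e. the number of monomials of degree exactly $d$ that are not in $I$. Convention: $0^0=1$. *)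

theory Defs
  imports "HOL-Probability.Probability" "HOL-Library.Poly_Mapping"
begin

text \<open>
  The polynomial ring \<open>k[x\<^sub>1,\<dots>,x\<^sub>n]\<close> is the type \<open>('n::finite, 'k::field) mpoly\<close> with \<open>n = CARD('n)\<close>:
  a polynomial is a finitely supported coefficient function on exponent vectors, with the
  (convolution) ring structure of \<^theory>\<open>HOL-Library.Poly_Mapping\<close>.
\<close>

type_synonym ('n, 'k) mpoly = "('n \<Rightarrow>\<^sub>0 nat) \<Rightarrow>\<^sub>0 'k"

definition monomial :: "('n \<Rightarrow>\<^sub>0 nat) \<Rightarrow> ('n, 'k::field) mpoly" where
  "monomial a = Poly_Mapping.single a 1"

definition mdeg :: "('n::finite \<Rightarrow>\<^sub>0 nat) \<Rightarrow> nat" where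
  "mdeg a = (\<Sum>i\<in>UNIV. Poly_Mapping.lookup a i)"

definition monomials :: "('n, 'k::field) mpoly set" where
  "monomials = {monomial a | a. True}"

definition monomials_of_degree :: "nat \<Rightarrow> ('n::finite, 'k::field) mpoly set" where
  "monomials_of_degree d = {monomial a | a. mdeg a = d}"

definition nonconst_monomials_upto :: "nat \<Rightarrow> ('n::finite, 'k::field) mpoly set" where
  "nonconst_monomials_upto D = {monomial a | a. a \<noteq> 0 \<and> mdeg a \<le> D}"

text \<open>
  The ideal generated by \<open>B\<close> is the submodule spanned by \<open>B\<close> when the ring is regarded as a
  module over itself; in particular \<open>ideal_gen {} = {0}\<close>.
\<close>

definition ideal_gen :: "'a::comm_ring_1 set \<Rightarrow> 'a set" where
  "ideal_gen B = module.span (*) B"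

text \<open>
  A minimal monomial generating set is minimal with respect to inclusion. Every monomial ideal
  has exactly one (lemma \<open>ex1_minimal_monomial_generating_set\<close> below), so that the definite
  description in the following definition of \<open>\<beta>\<^sub>1(S/I)\<close> is meaningful.
\<close>

definition minimal_monomial_generating_set ::
  "('n, 'k::field) mpoly set \<Rightarrow> ('n, 'k) mpoly set \<Rightarrow> bool" where
  "minimal_monomial_generating_set I G \<longleftrightarrow>
     G \<subseteq> monomials \<and> ideal_gen G = I \<and> (\<forall>H. H \<subset> G \<longrightarrow> ideal_gen H \<noteq> I)"

definition beta1 :: "('n, 'k::field) mpoly set \<Rightarrow> nat" where
  "beta1 I = card (THE G. minimal_monomial_generating_set I G)"

definition hilbert_function :: "('n::finite, 'k::field) mpoly set \<Rightarrow> nat \<Rightarrow> nat" where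
  "hilbert_function I d = card {m \<in> monomials_of_degree d. m \<notin> I}"

text \<open>
  The distribution \<open>\<B>(n,D,p)\<close>: one independent Bernoulli trial for every monomial in the
  (finite) index set decides whether that monomial is included.
\<close>

definition random_monomials :: "nat \<Rightarrow> real \<Rightarrow> ('n::finite, 'k::field) mpoly set pmf" where
  "random_monomials D p =
     map_pmf (\<lambda>f. {m \<in> nonconst_monomials_upto D. f m})
       (Pi_pmf (nonconst_monomials_upto D) False (\<lambda>_. bernoulli_pmf p))"

definition random_monomial_ideal :: "nat \<Rightarrow> real \<Rightarrow> ('n::finite, 'k::field) mpoly set pmf" where
  "random_monomial_ideal D p = map_pmf ideal_gen (random_monomials D p)"


lemma finite_exponents_mdeg_le: "finite {a :: 'n::finite \<Rightarrow>\<^sub>0 nat. mdeg a \<le> D}"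
proof -
  have "Poly_Mapping.lookup ` {a :: 'n \<Rightarrow>\<^sub>0 nat. mdeg a \<le> D} \<subseteq> PiE UNIV (\<lambda>_. {..D})"
  proof (intro subsetI)
    fix f assume "f \<in> Poly_Mapping.lookup ` {a :: 'n \<Rightarrow>\<^sub>0 nat. mdeg a \<le> D}"
    then obtain a :: "'n \<Rightarrow>\<^sub>0 nat" where a: "f = Poly_Mapping.lookup a" "mdeg a \<le> D" by auto
    have "Poly_Mapping.lookup a i \<le> mdeg a" for i
      unfolding mdeg_def by (rule member_le_sum) auto
    then show "f \<in> PiE UNIV (\<lambda>_. {..D})" using a by (auto intro: order_trans)
  qed
  then have "finite (Poly_Mapping.lookup ` {a :: 'n \<Rightarrow>\<^sub>0 nat. mdeg a \<le> D})"
    by (rule finite_subset) (intro finite_PiE, auto)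
  then show ?thesis
    by (rule finite_imageD) (simp add: inj_on_def poly_mapping_eqI)
qed

lemma finite_nonconst_monomials_upto:
  "finite (nonconst_monomials_upto D :: ('n::finite, 'k::field) mpoly set)"
proof -
  have "(nonconst_monomials_upto D :: ('n, 'k) mpoly set) \<subseteq> monomial ` {a. mdeg a \<le> D}"
    by (auto simp: nonconst_monomials_upto_def)
  then show ?thesis using finite_exponents_mdeg_le finite_subset by blast
qed

lemma finite_monomials_of_degree:
  "finite (monomials_of_degree d :: ('n::finite, 'k::field) mpoly set)"
proof -
  have "(monomials_of_degree d :: ('n, 'k) mpoly set) \<subseteq> monomial ` {a. mdeg a \<le> d}"
    by (auto simp: monomials_of_degree_def)
  then show ?thesis using finite_exponents_mdeg_le finite_subset by blast
qed

lemma module_times: "module ((*) :: 'a::comm_ring_1 \<Rightarrow> 'a \<Rightarrow> 'a)"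
  by unfold_locales (simp_all add: algebra_simps)

lemma ideal_gen_mono: "A \<subseteq> B \<Longrightarrow> ideal_gen A \<subseteq> ideal_gen B"
  unfolding ideal_gen_def by (rule module.span_mono[OF module_times])

lemma ideal_gen_base: "a \<in> A \<Longrightarrow> a \<in> ideal_gen A"
  unfolding ideal_gen_def by (rule module.span_base[OF module_times])

lemma ideal_gen_mult: "a \<in> ideal_gen A \<Longrightarrow> c * a \<in> ideal_gen A"
  unfolding ideal_gen_def by (rule module.span_scale[OF module_times])

lemma ideal_gen_least: "A \<subseteq> ideal_gen B \<Longrightarrow> ideal_gen A \<subseteq> ideal_gen B"
  unfolding ideal_gen_def
  by (rule module.span_minimal[OF module_times _ module.subspace_span[OF module_times]])

lemma monomial_add: "monomial (a + b) = (monomial a * monomial b :: ('n, 'k::field) mpoly)"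
  by (simp add: monomial_def mult_single)

lemma monomial_in_ideal_gen:
  assumes "(monomial a :: ('n, 'k::field) mpoly) \<in> ideal_gen G" "G \<subseteq> monomials"
  obtains b c where "monomial b \<in> G" "a = b + c"
proof -
  have *: "\<exists>b c. (monomial b :: ('n, 'k) mpoly) \<in> G \<and> x = b + c"
    if "f \<in> ideal_gen G" "x \<in> Poly_Mapping.keys f" for f x
    using that unfolding ideal_gen_def
  proof (induction arbitrary: x rule: module.span_induct_alt[OF module_times, consumes 1])
    case 1 then show ?case by simp
  next
    case (2 q g r)
    obtain b where b: "g = monomial b" using 2(1) assms(2) by (auto simp: monomials_def)
    have "x \<in> Poly_Mapping.keys (q * g) \<union> Poly_Mapping.keys r" using 2(3) keys_add[of "q * g" r] by auto
    then show ?case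
    proof
      assume "x \<in> Poly_Mapping.keys (q * g)"
      then obtain u v where "u \<in> Poly_Mapping.keys q" "v \<in> Poly_Mapping.keys g" "x = u + v"
        using keys_mult[of q g] by auto
      then have "x = b + u" by (auto simp: b monomial_def add.commute split: if_splits)
      then show ?thesis using 2(1) b by blast
    qed (rule 2(2))
  qed
  have "a \<in> Poly_Mapping.keys (monomial a :: ('n, 'k) mpoly)" by (simp add: monomial_def)
  from *[OF assms(1) this] that show ?thesis by blast
qed

lemma ex1_minimal_monomial_generating_set:
  assumes "A \<subseteq> (monomials :: ('n::finite, 'k::field) mpoly set)"
  shows "\<exists>!G. minimal_monomial_generating_set (ideal_gen A) G"
proof -
  define I where "I = ideal_gen A"
  define M :: "('n, 'k) mpoly set"
    where "M = {monomial a | a. monomial a \<in> I \<and> (\<forall>b c. monomial b \<in> I \<longrightarrow> a = b + c \<longrightarrow> c = 0)}"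
  have M: "M \<subseteq> monomials" "M \<subseteq> I" by (auto simp: M_def monomials_def)
  have deg: "mdeg (b + c) = mdeg b + mdeg c" for b c :: "'n \<Rightarrow>\<^sub>0 nat"
    by (simp add: mdeg_def lookup_add sum.distrib)
  have deg0: "mdeg c = 0 \<longleftrightarrow> c = 0" for c :: "'n \<Rightarrow>\<^sub>0 nat"
    by (auto simp: mdeg_def intro: poly_mapping_eqI)
  have "(monomial a :: ('n, 'k) mpoly) \<in> ideal_gen M" if "monomial a \<in> I" for a
    using that
  proof (induction "mdeg a" arbitrary: a rule: less_induct)
    case less
    show ?case
    proof (cases "monomial a \<in> M")
      case True then show ?thesis by (rule ideal_gen_base)
    next
      case False
      then obtain b c where bc: "monomial b \<in> I" "a = b + c" "c \<noteq> 0"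
        using less.prems unfolding M_def by blast
      then have "(monomial b :: ('n, 'k) mpoly) \<in> ideal_gen M"
        using less.hyps[of b] deg0[of c] by (simp add: deg)
      from ideal_gen_mult[OF this, of "monomial c"] show ?thesis
        by (simp add: bc(2) monomial_add mult.commute)
    qed
  qed
  then have "A \<subseteq> ideal_gen M"
    using assms ideal_gen_base[of _ A] by (auto simp: monomials_def I_def)
  then have gen: "ideal_gen M = I"
    using ideal_gen_least[of A M] ideal_gen_least[of M A] M by (auto simp: I_def)
  have contains: "M \<subseteq> G" if G: "G \<subseteq> monomials" "ideal_gen G = I" for G
  proof
    fix m assume "m \<in> M"
    then obtain a where a: "m = monomial a" "monomial a \<in> I"
      "\<forall>b c. (monomial b :: ('n, 'k) mpoly) \<in> I \<longrightarrow> a = b + c \<longrightarrow> c = 0"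
      by (auto simp: M_def)
    obtain b c where bc: "(monomial b :: ('n, 'k) mpoly) \<in> G" "a = b + c"
      using monomial_in_ideal_gen[of a G] a(2) G by blast
    then have "c = 0" using a(3) G(2) ideal_gen_base[OF bc(1)] by blast
    then show "m \<in> G" using a bc by simp
  qed
  have "minimal_monomial_generating_set I M"
    unfolding minimal_monomial_generating_set_def using M gen contains by blast
  moreover have "G = M" if "minimal_monomial_generating_set I G" for G
    using that contains[of G] gen M
    unfolding minimal_monomial_generating_set_def by blast
  ultimately show ?thesis unfolding I_def by blast
qed

end

theory Submission
  imports Defs
begin

text \<open>
  A finite set \<open>B\<close> of monomials generates \<open>I\<close> iff \<open>G \<subseteq> B \<subseteq> I\<close>, where \<open>G\<close> is the minimal monomial generating set
  of \<open>I\<close>. Indeed \<open>B \<subseteq> I\<close> and \<open>G \<subseteq> B\<close> squeeze the ideal of \<open>B\<close> between those of \<open>G\<close> and \<open>I\<close>; and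
  conversely a finite generating set \<open>B\<close> can be thinned to a minimal one, which is \<open>G\<close> by
  uniqueness (\<open>ideal_gen_eq_iff\<close>).

  So the event that the random ideal is \<open>I\<close> prescribes the outcomes of exactly two disjoint groups
  of independent trials: the \<open>\<beta>\<^sub>1(S/I)\<close> monomials of \<open>G\<close> must be chosen, and the monomials of degree
  \<open>1,\<dots>,D\<close> outside \<open>I\<close> must not be. The Hilbert function counts the latter degree by degree
  (\<open>card_standard_monomials_upto\<close>), and the product formula for independent trials gives the result.
\<close>

lemma finite_generating_set_contains_minimal:
  fixes B :: "('n, 'k::field) mpoly set"
  assumes "finite B" "B \<subseteq> monomials"
  obtains H where "H \<subseteq> B" "minimal_monomial_generating_set (ideal_gen B) H"
proof -
  let ?S = "{H. H \<subseteq> B \<and> ideal_gen H = ideal_gen B}"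
  have "finite ?S" using assms(1) by simp
  moreover have "B \<in> ?S" by simp
  ultimately have "\<exists>H\<in>?S. \<forall>H'\<in>?S. H' \<subseteq> H \<longrightarrow> H = H'"
    by (metis (lifting) finite_has_minimal empty_iff)
  then obtain H where H: "H \<subseteq> B" "ideal_gen H = ideal_gen B"
    and min: "\<forall>H'\<in>?S. H' \<subseteq> H \<longrightarrow> H = H'" by auto
  have "ideal_gen H' \<noteq> ideal_gen B" if "H' \<subset> H" for H'
    using min H(1) that by auto
  then have "minimal_monomial_generating_set (ideal_gen B) H"
    unfolding minimal_monomial_generating_set_def using H assms(2) by simp
  with H(1) show thesis by (rule that)
qed

text \<open>
  Since \<open>G\<close> is the only minimal monomial generating set of \<open>I\<close>, thinning any other finite
  monomial generating set down to a minimal one must arrive at \<open>G\<close>. Hence every such set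
  contains \<open>G\<close>, and generating \<open>I\<close> is an interval condition on \<open>B\<close>, decided monomial by monomial.
\<close>

lemma ideal_gen_eq_iff:
  fixes B :: "('n::finite, 'k::field) mpoly set"
  assumes B: "finite B" "B \<subseteq> monomials"
    and G: "minimal_monomial_generating_set I G"
  shows "ideal_gen B = I \<longleftrightarrow> G \<subseteq> B \<and> B \<subseteq> I"
proof
  assume I: "ideal_gen B = I"
  obtain H where "H \<subseteq> B" "minimal_monomial_generating_set I H"
    using finite_generating_set_contains_minimal[OF B] I by metis
  moreover from this have "H = G"
    using ex1_minimal_monomial_generating_set[OF B(2)] G I by blast
  ultimately show "G \<subseteq> B \<and> B \<subseteq> I" using I ideal_gen_base by blast
next
  assume "G \<subseteq> B \<and> B \<subseteq> I"
  moreover have "ideal_gen G = I" using G by (simp add: minimal_monomial_generating_set_def)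
  ultimately show "ideal_gen B = I"
    using ideal_gen_mono[of G B] ideal_gen_least[of B G] by blast
qed

lemma beta1_eq_card:
  assumes "A \<subseteq> (monomials :: ('n::finite, 'k::field) mpoly set)"
    and "minimal_monomial_generating_set (ideal_gen A) G"
  shows "beta1 (ideal_gen A) = card G"
  unfolding beta1_def
  using the1_equality[OF ex1_minimal_monomial_generating_set[OF assms(1)] assms(2)] by simp

lemma monomial_eq_iff [simp]:
  "(monomial a :: ('n, 'k::field) mpoly) = monomial b \<longleftrightarrow> a = b"
  by (auto simp: monomial_def dest: arg_cong[where f = Poly_Mapping.keys])

lemma mdeg_eq_0_iff: "mdeg a = 0 \<longleftrightarrow> a = 0"
  by (auto simp: mdeg_def intro: poly_mapping_eqI)

lemma nonconst_monomials_upto_eq_Union: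
  "(nonconst_monomials_upto D :: ('n::finite, 'k::field) mpoly set) =
     (\<Union>d\<in>{1..D}. monomials_of_degree d)"
proof -
  have "a \<noteq> 0 \<longleftrightarrow> 1 \<le> mdeg a" for a :: "'n \<Rightarrow>\<^sub>0 nat"
    using mdeg_eq_0_iff[of a] by linarith
  then show ?thesis
    by (auto simp only: nonconst_monomials_upto_def monomials_of_degree_def
        UN_iff mem_Collect_eq atLeastAtMost_iff)
qed

lemma card_standard_monomials_upto:
  fixes I :: "('n::finite, 'k::field) mpoly set"
  shows "card (nonconst_monomials_upto D - I) = (\<Sum>d = 1..D. hilbert_function I d)"
proof -
  have "nonconst_monomials_upto D - I = (\<Union>d\<in>{1..D}. {m \<in> monomials_of_degree d. m \<notin> I})"
    by (auto simp: nonconst_monomials_upto_eq_Union)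
  also have "card \<dots> = (\<Sum>d = 1..D. card {m \<in> monomials_of_degree d. m \<notin> I})"
    by (rule card_UN_disjoint)
      (auto simp: finite_monomials_of_degree, auto simp: monomials_of_degree_def)
  finally show ?thesis by (simp add: hilbert_function_def)
qed

lemma prob_random_subset_between:
  assumes N: "finite N" and G: "G \<subseteq> N" "G \<subseteq> I" and p: "0 \<le> p" "p \<le> 1"
  shows "measure_pmf.prob (Pi_pmf N False (\<lambda>_. bernoulli_pmf p))
           {f. G \<subseteq> {m \<in> N. f m} \<and> {m \<in> N. f m} \<subseteq> I} = p ^ card G * (1 - p) ^ card (N - I)"
proof -
  \<comment> \<open>The event is a product set: each trial is forced to succeed, forced to fail, or left free.
    As \<open>G \<subseteq> I\<close>, no trial is forced both ways.\<close>
  define F where "F m = (if m \<in> G then {True} else if m \<in> I then UNIV else {False})" for m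
  have prob: "measure_pmf.prob (bernoulli_pmf p) (F m) =
      (if m \<in> G then p else 1) * (if m \<in> N - I then 1 - p else 1)" if "m \<in> N" for m
    using that G p by (auto simp: F_def measure_pmf_single)
  have "{f. G \<subseteq> {m \<in> N. f m} \<and> {m \<in> N. f m} \<subseteq> I} = Pi N F"
    using G by (auto simp: F_def Pi_def split: if_splits)
  then have "measure_pmf.prob (Pi_pmf N False (\<lambda>_. bernoulli_pmf p))
      {f. G \<subseteq> {m \<in> N. f m} \<and> {m \<in> N. f m} \<subseteq> I}
      = (\<Prod>m\<in>N. measure_pmf.prob (bernoulli_pmf p) (F m))"
    by (simp add: measure_Pi_pmf_Pi[OF N])
  also have "\<dots> = (\<Prod>m\<in>N. if m \<in> G then p else 1) * (\<Prod>m\<in>N. if m \<in> N - I then 1 - p else 1)"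
    by (simp add: prob prod.distrib cong: prod.cong)
  also have "\<dots> = p ^ card G * (1 - p) ^ card (N - I)"
    using N G(1) by (simp add: prod.inter_restrict[symmetric] Int_absorb1 del: Diff_iff)
  finally show ?thesis .
qed

lemma prob_random_monomial_ideal:
  fixes I :: "('n::finite, 'k::field) mpoly set"
  assumes p: "0 \<le> p" "p \<le> 1"
    and A: "A \<subseteq> nonconst_monomials_upto D" "I = ideal_gen A"
  shows "measure_pmf.prob (random_monomial_ideal D p) {I} =
           p ^ beta1 I * (1 - p) ^ (\<Sum>d = 1..D. hilbert_function I d)"
proof -
  let ?N = "nonconst_monomials_upto D :: ('n, 'k) mpoly set"
  have N: "?N \<subseteq> monomials" by (auto simp: nonconst_monomials_upto_def monomials_def)
  note finN = finite_nonconst_monomials_upto[where ?'n = 'n and ?'k = 'k, of D]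
  have finA: "finite A" and monA: "A \<subseteq> monomials"
    using A(1) N finN by (auto intro: finite_subset)
  obtain G where G: "G \<subseteq> A" "minimal_monomial_generating_set I G"
    using finite_generating_set_contains_minimal[OF finA monA] A(2) by blast
  have GI: "G \<subseteq> I" using G(1) A(2) ideal_gen_base by blast
  have "ideal_gen {m \<in> ?N. f m} = I \<longleftrightarrow> G \<subseteq> {m \<in> ?N. f m} \<and> {m \<in> ?N. f m} \<subseteq> I" for f
    using N finN by (intro ideal_gen_eq_iff[OF _ _ G(2)]) auto
  then have "(\<lambda>f. ideal_gen {m \<in> ?N. f m}) -` {I} =
      {f. G \<subseteq> {m \<in> ?N. f m} \<and> {m \<in> ?N. f m} \<subseteq> I}"
    by (simp add: vimage_def)
  then have "measure_pmf.prob (random_monomial_ideal D p) {I} = p ^ card G * (1 - p) ^ card (?N - I)"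
    using prob_random_subset_between[OF finN subset_trans[OF G(1) A(1)] GI p]
    by (simp add: random_monomial_ideal_def random_monomials_def map_pmf_comp)
  then show ?thesis
    using beta1_eq_card[OF monA] G(2) A(2) by (simp add: card_standard_monomials_upto)
qed

theorem theorem1p1:
  fixes D :: nat
    and p :: real
    and I :: "('n::finite, 'k::field) mpoly set"
    and M :: "'w measure"
    and J :: "'w \<Rightarrow> ('n, 'k) mpoly set"
  assumes "D \<ge> 1"
    and "0 \<le> p" "p \<le> 1"
    and "\<exists>G \<subseteq> nonconst_monomials_upto D. I = ideal_gen G"
    and "prob_space M"
    and "J \<in> measurable M (count_space UNIV)"
    and "distr M (count_space UNIV) J = measure_pmf (random_monomial_ideal D p)"
  shows "measure M {w \<in> space M. J w = I} =
           p ^ beta1 I * (1 - p) ^ (\<Sum>d = 1..D. hilbert_function I d)"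
proof -
  have "{w \<in> space M. J w = I} = J -` {I} \<inter> space M" by auto
  then have "measure M {w \<in> space M. J w = I} =
      measure (distr M (count_space UNIV) J) {I}"
    using assms(6) by (simp add: measure_distr)
  also have "\<dots> = measure_pmf.prob (random_monomial_ideal D p) {I}"
    by (simp only: assms(7))
  finally have law: "measure M {w \<in> space M. J w = I} =
      measure_pmf.prob (random_monomial_ideal D p) {I}" .
  obtain A where "A \<subseteq> nonconst_monomials_upto D" "I = ideal_gen A"
    using assms(4) by blast
  then show ?thesis
    unfolding law by (rule prob_random_monomial_ideal[OF assms(2,3)])
qed

end
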